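(* Let $V,W,\sigma$ be unitary operators on a Hilbert space $\mathcal{H}_0$ satisfying conditions (QW1)–(QW4) and let $e\in\pi_+\mathcal{H}_0$ be a unit vector for which condition (QWR) holds (all conditions as listed in the context). Let $s,t\in\mathbb{R}$ with $s^2+t^2=1$, $U=sV+tW$, let $\psi={}^t(\psi_1,\psi_2)$ be a unit vector in $\mathbb{C}^2$, let $n$ be a positive integer, and let $q_n(\psi;x)$ be the associated probability distribution on $\mathbb{Z}$. With the Laurent polynomials $p_n^i,q_n^i$ $(i=1,2)$ and the coefficient notation $c_x(\cdot)$ of the context, for every $x\in\mathbb{Z}$, $$\begin{aligned} q_n(\psi;x)={}&|\psi_1|^2\left[c_x(p_n^1)^2+c_x(p_n^2)^2\right]+|\psi_2|^2\left[c_x(q_n^1)^2+c_x(q_n^2)^2\right]\\ &+2\,\mathrm{Re}(\psi_1\overline{\psi}_2)\left[c_x(p_n^1)c_x(q_n^1)+c_x(p_n^2)c_x(q_n^2)\right].\end{aligned}$$ In particular, the characteristic function $E_n(\xi)=\sum_{x\in\mathbb{Z}}q_n(\psi;x)e^{i\xi x}$, $\xi\in\mathbb{R}$, is given by $$E_n(\xi)=|\psi_1|^2\left[P_n^1(\xi)+P_n^2(\xi)\right]+|\psi_2|^2\left[Q_n^1(\xi)+Q_n^2(\xi)\right]+2\,\mathrm{Re}(\psi_1\overline{\psi}_2)\left[R_n^1(\xi)+R_n^2(\xi)\right],$$ where, for $i=1,2$ (the $i$ in the exponent $e^{i\xi x}$ being the imaginary unit), $$P_n^i(\xi)=\sum_{x\in\mathbb{Z}}c_x(p_n^i)^2e^{i\xi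 x},\quad Q_n^i(\xi)=\sum_{x\in\mathbb{Z}}c_x(q_n^i)^2e^{i\xi x},\quad R_n^i(\xi)=\sum_{x\in\mathbb{Z}}c_x(p_n^i)c_x(q_n^i)e^{i\xi x}.$$
   Context: Setting. $\mathcal{H}_0$ is a complex Hilbert space with inner product $\langle\cdot,\cdot\rangle$ (linear in the first variable), and $V,W,\sigma$ are unitary operators on $\mathcal{H}_0$ such that: (QW1) $W^2=-I$; (QW2) $VW=WV^{-1}$; (QW3) $\sigma W+W\sigma=0$ and $\sigma V-V\sigma=0$; (QW4) $\sigma^*=\sigma$. Put $\pi_\pm=\frac12(I\pm\sigma)$, the projections onto the eigenspaces of $\sigma$ with eigenvalue $\pm1$. Condition (QWR): $e\in\pi_+\mathcal{H}_0$ is a unit vector with $\langle V^xe,e\rangle=0$ for every positive integer $x$. Put $X=\frac12(V+V^* )$, $Y=\frac1{2i}(V-V^* )$, $T=X+i\sigma Y$ (a unitary operator), and $\epsilon=VW$. For $x\in\mathbb{Z}$ let $e_1^x=T^xe$, $e_2^x=T^x\epsilon e$, and $e_1=e_1^0$, $e_2=e_2^0$. The vectors $e_i^x$ ($i=1,2$, $x\in\mathbb{Z}$) form an orthonormal system in $\mathcal{H}_0$, and $\mathcal{H}$, the closed linear span of them, is preserved by $V$, $W$, $\sigma$ and their inverses; hence $U=sV+tW$ is a unitary operator on $\mathcal{H}_0$ and on $\mathcal{H}$. For a unit vector $\psi={}^t(\psi_1,\psi_2)\in\mathbb{C}^2$ put $\Psi=\psi_1e_1+\psi_2e_2$ and $$q_n(\psi;x)=|\langle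 U^n\Psi,e_1^x\rangle|^2+|\langle U^n\Psi,e_2^x\rangle|^2,\quad x\in\mathbb{Z},$$ which is a probability distribution on $\mathbb{Z}$. Chebyshev polynomials: $T_n(\cos\theta)=\cos n\theta$ and $U_{n-1}(\cos\theta)=\frac{\sin n\theta}{\sin\theta}$ (the polynomials $T_n$, $U_{n-1}$ are not to be confused with the operators $T$, $U$). The Laurent polynomials with real coefficients $p_n^i(z),q_n^i(z)$ are $$\begin{aligned} p_n^1(z)&=T_n(s(z+z^{-1})/2)+\tfrac{s}{2}(z-z^{-1})U_{n-1}(s(z+z^{-1})/2),\\ p_n^2(z)&=tz\,U_{n-1}(s(z+z^{-1})/2),\\ q_n^1(z)&=-tz^{-1}U_{n-1}(s(z+z^{-1})/2),\\ q_n^2(z)&=T_n(s(z+z^{-1})/2)-\tfrac{s}{2}(z-z^{-1})U_{n-1}(s(z+z^{-1})/2).\end{aligned}$$ For a Laurent polynomial $p(z)$ and $x\in\mathbb{Z}$, $c_x(p)$ denotes the coefficient of $z^x$ in $p(z)$. *)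

theory Defs
  imports "HOL-Analysis.Analysis" "HOL-Library.Poly_Mapping" "HOL-Computational_Algebra.Polynomial"
begin

text \<open>
  The real structure (norm, topology, completeness) is inherited from \<^class>\<open>real_inner\<close>
  and \<^class>\<open>complete_space\<close>; the last two axioms tie it to the complex one. The complex inner
  product is linear in its first argument.
\<close>

class complex_hilbert_space = real_inner + complete_space +
  fixes scaleC :: "complex \<Rightarrow> 'a \<Rightarrow> 'a"  (infixr \<open>*\<^sub>C\<close> 75)
    and cinner :: "'a \<Rightarrow> 'a \<Rightarrow> complex"
  assumes scaleC_add_right: "a *\<^sub>C (x + y) = a *\<^sub>C x + a *\<^sub>C y"
    and scaleC_add_left: "(a + b) *\<^sub>C x = a *\<^sub>C x + b *\<^sub>C x"
    and scaleC_scaleC: "a *\<^sub>C b *\<^sub>C x = (a * b) *\<^sub>C x"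
    and cinner_commute: "cinner x y = cnj (cinner y x)"
    and cinner_add_left: "cinner (x + y) z = cinner x z + cinner y z"
    and cinner_scaleC_left: "cinner (a *\<^sub>C x) y = a * cinner x y"
    and scaleR_scaleC: "r *\<^sub>R x = complex_of_real r *\<^sub>C x"
    and inner_cinner: "inner x y = Re (cinner x y)"

lemma scaleC_one: "1 *\<^sub>C x = (x :: 'a::complex_hilbert_space)"
  using scaleR_scaleC[of 1 x] by simp

lemma cinner_self: "cinner x x = complex_of_real ((norm x)\<^sup>2)"
  for x :: "'a::complex_hilbert_space"
proof (rule complex_eqI)
  show "Re (cinner x x) = Re (complex_of_real ((norm x)\<^sup>2))"
    by (simp add: power2_norm_eq_inner inner_cinner)
  show "Im (cinner x x) = Im (complex_of_real ((norm x)\<^sup>2))"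
    using arg_cong[OF cinner_commute[of x x], of Im] by simp
qed

lemma vector_space_scaleC: "vector_space (scaleC :: complex \<Rightarrow> 'a \<Rightarrow> 'a::complex_hilbert_space)"
  by unfold_locales (simp_all add: scaleC_add_right scaleC_add_left scaleC_scaleC scaleC_one)

instantiation complex :: complex_hilbert_space
begin

definition scaleC_complex :: "complex \<Rightarrow> complex \<Rightarrow> complex"
  where "scaleC_complex a x = a * x"

definition cinner_complex :: "complex \<Rightarrow> complex \<Rightarrow> complex"
  where "cinner_complex x y = x * cnj y"

instance
  by standard
    (simp_all add: scaleC_complex_def cinner_complex_def algebra_simps scaleR_conv_of_real
      inner_complex_def)

end


definition unitary_op :: "('a::complex_hilbert_space \<Rightarrow> 'a) \<Rightarrow> bool"
  where "unitary_op A \<longleftrightarrow>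
    Vector_Spaces.linear scaleC scaleC A \<and> surj A \<and> (\<forall>x y. cinner (A x) (A y) = cinner x y)"

definition cadjoint :: "('a::complex_hilbert_space \<Rightarrow> 'a) \<Rightarrow> 'a \<Rightarrow> 'a"
  where "cadjoint A = (SOME B. \<forall>x y. cinner (A x) y = cinner x (B y))"

lemma cadjoint_unique:
  fixes A :: "'a::complex_hilbert_space \<Rightarrow> 'a"
  assumes B: "\<And>x y. cinner (A x) y = cinner x (B y)"
  shows "cadjoint A = B"
proof
  fix y
  have "\<forall>x y. cinner (A x) y = cinner x (cadjoint A y)"
    unfolding cadjoint_def by (rule someI[of _ B]) (simp add: B)
  then have "cinner x (cadjoint A y) = cinner x (B y)" for x
    using B by metis
  then have "inner x (cadjoint A y) = inner x (B y)" for x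
    by (simp add: inner_cinner)
  then show "cadjoint A y = B y"
    by (metis vector_eq_rdot inner_commute)
qed

lemma unitary_op_inj:
  assumes "unitary_op A"
  shows "inj A"
proof (rule injI)
  fix x y assume eq: "A x = A y"
  have pres: "inner (A u) (A v) = inner u v" for u v
    using assms by (simp add: unitary_op_def inner_cinner)
  have "inner x z = inner y z" for z
    using pres[of x z] pres[of y z] eq by simp
  then show "x = y"
    by (metis vector_eq_rdot)
qed

lemma unitary_op_cadjoint:
  assumes A: "unitary_op A"
  shows "cadjoint A = inv A"
proof (rule cadjoint_unique)
  fix x y
  have "surj A"
    using A by (simp add: unitary_op_def)
  then have "cinner (A x) y = cinner (A x) (A (inv A y))"
    by (simp add: surj_f_inv_f)
  also have "\<dots> = cinner x (inv A y)"
    using A by (simp add: unitary_op_def)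
  finally show "cinner (A x) y = cinner x (inv A y)" .
qed

definition op_powi :: "('a \<Rightarrow> 'a) \<Rightarrow> int \<Rightarrow> 'a \<Rightarrow> 'a"
  where "op_powi A k = (if 0 \<le> k then A ^^ nat k else inv A ^^ nat (- k))"


definition cheb_T :: "nat \<Rightarrow> real poly"
  where "cheb_T n = (THE p. \<forall>\<theta>. poly p (cos \<theta>) = cos (real n * \<theta>))"

definition cheb_U :: "nat \<Rightarrow> real poly"
  where "cheb_U n =
    (THE p. \<forall>\<theta>. sin \<theta> \<noteq> 0 \<longrightarrow> poly p (cos \<theta>) = sin (real (n + 1) * \<theta>) / sin \<theta>)"

lemma poly_eq_if_eq_on_cos:
  fixes p q :: "real poly"
  assumes "\<And>\<theta>. sin \<theta> \<noteq> 0 \<Longrightarrow> poly p (cos \<theta>) = poly q (cos \<theta>)"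
  shows "p = q"
proof (rule ccontr)
  assume "p \<noteq> q"
  then have "finite {x. poly (p - q) x = 0}"
    by (intro poly_roots_finite) simp
  moreover have "{-1<..<1} \<subseteq> {x. poly (p - q) x = 0}"
  proof
    fix x :: real assume x: "x \<in> {-1<..<1}"
    then have "cos (arccos x) = x" "sin (arccos x) \<noteq> 0"
      using sin_arccos_nonzero[of x] by auto
    then show "x \<in> {x. poly (p - q) x = 0}"
      using assms[of "arccos x"] by simp
  qed
  ultimately have "finite {-1<..<1::real}"
    by (rule rev_finite_subset)
  then show False
    by (simp add: infinite_Ioo)
qed

lemma cheb_T_exists: "\<exists>p. \<forall>\<theta>. poly p (cos \<theta>) = cos (real n * \<theta>)"
proof (induction n rule: less_induct)
  case (less n)
  consider "n = 0" | "n = 1" | m where "n = m + 2"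
    by (metis One_nat_def add_2_eq_Suc' not0_implies_Suc)
  then show ?case
  proof cases
    case 1
    then show ?thesis by (intro exI[of _ 1]) simp
  next
    case 2
    then show ?thesis by (intro exI[of _ "[:0, 1:]"]) simp
  next
    case 3
    from less.IH[of m] 3 obtain p where p: "\<And>\<theta>. poly p (cos \<theta>) = cos (real m * \<theta>)" by auto
    from less.IH[of "m + 1"] 3 obtain q
      where q: "\<And>\<theta>. poly q (cos \<theta>) = cos (real (m + 1) * \<theta>)" by auto
    have "poly ([:0, 2:] * q - p) (cos \<theta>) = cos (real n * \<theta>)" for \<theta>
    proof -
      have "cos (real n * \<theta>) = cos (real (m + 1) * \<theta> + \<theta>)"
        and "cos (real m * \<theta>) = cos (real (m + 1) * \<theta> - \<theta>)"
        using 3 by (simp_all add: algebra_simps)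
      then show ?thesis
        by (simp add: p q cos_add cos_diff)
    qed
    then show ?thesis by blast
  qed
qed

lemma cheb_T_cos: "poly (cheb_T n) (cos \<theta>) = cos (real n * \<theta>)"
proof -
  have "\<exists>!p. \<forall>\<theta>. poly p (cos \<theta>) = cos (real n * \<theta>)"
    using cheb_T_exists[of n] by (metis poly_eq_if_eq_on_cos)
  from theI'[OF this] show ?thesis
    by (simp add: cheb_T_def)
qed

lemma cheb_U_exists: "\<exists>p. \<forall>\<theta>. poly p (cos \<theta>) * sin \<theta> = sin (real (n + 1) * \<theta>)"
proof (induction n rule: less_induct)
  case (less n)
  consider "n = 0" | "n = 1" | m where "n = m + 2"
    by (metis One_nat_def add_2_eq_Suc' not0_implies_Suc)
  then show ?case
  proof cases
    case 1
    then show ?thesis by (intro exI[of _ 1]) simp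
  next
    case 2
    then show ?thesis by (intro exI[of _ "[:0, 2:]"]) (simp add: sin_double)
  next
    case 3
    from less.IH[of m] 3 obtain p
      where p: "\<And>\<theta>. poly p (cos \<theta>) * sin \<theta> = sin (real (m + 1) * \<theta>)" by auto
    from less.IH[of "m + 1"] 3 obtain q
      where q: "\<And>\<theta>. poly q (cos \<theta>) * sin \<theta> = sin (real (m + 2) * \<theta>)"
      by (auto simp: algebra_simps)
    have "poly ([:0, 2:] * q - p) (cos \<theta>) * sin \<theta> = sin (real (n + 1) * \<theta>)" for \<theta>
    proof -
      have n: "sin (real (n + 1) * \<theta>) = sin (real (m + 2) * \<theta> + \<theta>)"
        and m: "sin (real (m + 1) * \<theta>) = sin (real (m + 2) * \<theta> - \<theta>)"
        using 3 by (simp_all add: algebra_simps)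
      have "poly ([:0, 2:] * q - p) (cos \<theta>) * sin \<theta>
          = 2 * cos \<theta> * (poly q (cos \<theta>) * sin \<theta>) - poly p (cos \<theta>) * sin \<theta>"
        by (simp add: algebra_simps)
      also have "\<dots> = sin (real (n + 1) * \<theta>)"
        unfolding p q n m sin_add sin_diff by (simp add: algebra_simps)
      finally show ?thesis .
    qed
    then show ?thesis by blast
  qed
qed

lemma cheb_U_cos:
  assumes "sin \<theta> \<noteq> 0"
  shows "poly (cheb_U n) (cos \<theta>) = sin (real (n + 1) * \<theta>) / sin \<theta>"
proof -
  let ?P = "\<lambda>p. \<forall>\<theta>. sin \<theta> \<noteq> 0 \<longrightarrow> poly p (cos \<theta>) = sin (real (n + 1) * \<theta>) / sin \<theta>"
  have "\<exists>p. ?P p"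
    using cheb_U_exists[of n] by (metis nonzero_eq_divide_eq)
  then have "\<exists>!p. ?P p"
    by (metis poly_eq_if_eq_on_cos)
  from theI'[OF this] assms show ?thesis
    by (simp add: cheb_U_def)
qed


text \<open>
  Real Laurent polynomials are the finitely supported functions on the integers with the
  convolution product; the coefficient of \<open>z\<^sup>x\<close> is given by \<^const>\<open>Poly_Mapping.lookup\<close>.
\<close>

type_synonym laurent = "int \<Rightarrow>\<^sub>0 real"

abbreviation laurent_const :: "real \<Rightarrow> laurent"
  where "laurent_const \<equiv> Poly_Mapping.single 0"

abbreviation laurent_z :: laurent
  where "laurent_z \<equiv> Poly_Mapping.single 1 1"

abbreviation laurent_z_inv :: laurent
  where "laurent_z_inv \<equiv> Poly_Mapping.single (- 1) 1"

abbreviation laurent_coeff :: "int \<Rightarrow> laurent \<Rightarrow> real"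
  where "laurent_coeff x p \<equiv> Poly_Mapping.lookup p x"

definition poly_laurent :: "real poly \<Rightarrow> laurent \<Rightarrow> laurent"
  where "poly_laurent p = poly (map_poly laurent_const p)"

definition walk_p1 :: "real \<Rightarrow> nat \<Rightarrow> laurent"
  where "walk_p1 s n =
    poly_laurent (cheb_T n) (laurent_const (s / 2) * (laurent_z + laurent_z_inv))
    + laurent_const (s / 2) * (laurent_z - laurent_z_inv)
      * poly_laurent (cheb_U (n - 1)) (laurent_const (s / 2) * (laurent_z + laurent_z_inv))"

definition walk_p2 :: "real \<Rightarrow> real \<Rightarrow> nat \<Rightarrow> laurent"
  where "walk_p2 s t n =
    laurent_const t * laurent_z
      * poly_laurent (cheb_U (n - 1)) (laurent_const (s / 2) * (laurent_z + laurent_z_inv))"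

definition walk_q1 :: "real \<Rightarrow> real \<Rightarrow> nat \<Rightarrow> laurent"
  where "walk_q1 s t n =
    - laurent_const t * laurent_z_inv
      * poly_laurent (cheb_U (n - 1)) (laurent_const (s / 2) * (laurent_z + laurent_z_inv))"

definition walk_q2 :: "real \<Rightarrow> nat \<Rightarrow> laurent"
  where "walk_q2 s n =
    poly_laurent (cheb_T n) (laurent_const (s / 2) * (laurent_z + laurent_z_inv))
    - laurent_const (s / 2) * (laurent_z - laurent_z_inv)
      * poly_laurent (cheb_U (n - 1)) (laurent_const (s / 2) * (laurent_z + laurent_z_inv))"


definition pi_plus :: "('a::complex_hilbert_space \<Rightarrow> 'a) \<Rightarrow> 'a \<Rightarrow> 'a"
  where "pi_plus \<sigma> v = (1/2) *\<^sub>R (v + \<sigma> v)"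

text \<open>
  \<open>V\<close>, \<open>W\<close>, \<open>\<sigma>\<close> are meant to be unitary with \<open>W\<^sup>2 = -I\<close>, \<open>VW = WV\<^sup>-\<^sup>1\<close>, and \<open>\<sigma>\<close> self-adjoint, commuting
  with \<open>V\<close> and anticommuting with \<open>W\<close>. Then \<open>walk_T\<close> is unitary, so its integer powers make sense, and
  the vectors \<open>walk_e1 x\<close>, \<open>walk_e2 x\<close> are the position basis of the walk \<open>sV + tW\<close>.
\<close>

definition walk_X :: "('a::complex_hilbert_space \<Rightarrow> 'a) \<Rightarrow> 'a \<Rightarrow> 'a"
  where "walk_X V v = (1/2) *\<^sub>R (V v + cadjoint V v)"

definition walk_Y :: "('a::complex_hilbert_space \<Rightarrow> 'a) \<Rightarrow> 'a \<Rightarrow> 'a"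
  where "walk_Y V v = (1 / (2 * \<i>)) *\<^sub>C (V v - cadjoint V v)"

definition walk_T :: "('a::complex_hilbert_space \<Rightarrow> 'a) \<Rightarrow> ('a \<Rightarrow> 'a) \<Rightarrow> 'a \<Rightarrow> 'a"
  where "walk_T V \<sigma> v = walk_X V v + \<i> *\<^sub>C \<sigma> (walk_Y V v)"

definition walk_e1 :: "('a::complex_hilbert_space \<Rightarrow> 'a) \<Rightarrow> ('a \<Rightarrow> 'a) \<Rightarrow> 'a \<Rightarrow> int \<Rightarrow> 'a"
  where "walk_e1 V \<sigma> e x = op_powi (walk_T V \<sigma>) x e"

definition walk_e2 ::
    "('a::complex_hilbert_space \<Rightarrow> 'a) \<Rightarrow> ('a \<Rightarrow> 'a) \<Rightarrow> ('a \<Rightarrow> 'a) \<Rightarrow> 'a \<Rightarrow> int \<Rightarrow> 'a"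
  where "walk_e2 V W \<sigma> e x = op_powi (walk_T V \<sigma>) x (V (W e))"

definition walk_U ::
    "('a::complex_hilbert_space \<Rightarrow> 'a) \<Rightarrow> ('a \<Rightarrow> 'a) \<Rightarrow> real \<Rightarrow> real \<Rightarrow> 'a \<Rightarrow> 'a"
  where "walk_U V W s t v = s *\<^sub>R V v + t *\<^sub>R W v"

definition walk_init ::
    "('a::complex_hilbert_space \<Rightarrow> 'a) \<Rightarrow> ('a \<Rightarrow> 'a) \<Rightarrow> ('a \<Rightarrow> 'a) \<Rightarrow> 'a \<Rightarrow> complex^2 \<Rightarrow> 'a"
  where "walk_init V W \<sigma> e \<psi> = \<psi>$1 *\<^sub>C walk_e1 V \<sigma> e 0 + \<psi>$2 *\<^sub>C walk_e2 V W \<sigma> e 0"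

definition walk_dist ::
    "('a::complex_hilbert_space \<Rightarrow> 'a) \<Rightarrow> ('a \<Rightarrow> 'a) \<Rightarrow> ('a \<Rightarrow> 'a) \<Rightarrow> 'a \<Rightarrow> real \<Rightarrow> real \<Rightarrow>
      nat \<Rightarrow> complex^2 \<Rightarrow> int \<Rightarrow> real"
  where "walk_dist V W \<sigma> e s t n \<psi> x =
    (cmod (cinner ((walk_U V W s t ^^ n) (walk_init V W \<sigma> e \<psi>)) (walk_e1 V \<sigma> e x)))\<^sup>2
    + (cmod (cinner ((walk_U V W s t ^^ n) (walk_init V W \<sigma> e \<psi>)) (walk_e2 V W \<sigma> e x)))\<^sup>2"

text \<open>
  Only used for finitely supported \<open>f\<close>, so the default value of divergent sums never
  matters.
\<close>

definition fourier_sum :: "(int \<Rightarrow> real) \<Rightarrow> real \<Rightarrow> complex"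
  where "fourier_sum f \<xi> =
    (\<Sum>\<^sub>\<infinity>x\<in>UNIV. complex_of_real (f x) * exp (\<i> * complex_of_real (\<xi> * real_of_int x)))"

end

theory Submission
  imports Defs
begin

text \<open>
  The vectors \<open>e\<^sub>1\<^sup>x\<close> and \<open>e\<^sub>2\<^sup>x\<close> lie in the eigenspaces of \<open>\<sigma>\<close> for \<open>1\<close> and \<open>-1\<close>, on which \<open>T\<close> acts as \<open>V\<close> and
  as \<open>V\<^sup>*\<close>. So \<open>V e\<^sub>1\<^sup>x = e\<^sub>1\<^sup>x\<^sup>+\<^sup>1\<close>, \<open>V e\<^sub>2\<^sup>x = e\<^sub>2\<^sup>x\<^sup>-\<^sup>1\<close>, \<open>W e\<^sub>1\<^sup>x = e\<^sub>2\<^sup>x\<^sup>+\<^sup>1\<close> and \<open>W e\<^sub>2\<^sup>x = - e\<^sub>1\<^sup>x\<^sup>-\<^sup>1\<close>. Encoding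
  the amplitudes of a vector at the \<open>e\<^sub>i\<^sup>x\<close> as coefficients of a pair of Laurent series, \<open>sV + tW\<close> is
  multiplication by the matrix \<open>M\<close> with rows \<open>(sz, -tz\<^sup>-\<^sup>1)\<close> and \<open>(tz, sz\<^sup>-\<^sup>1)\<close>. Its determinant is
  \<open>s\<^sup>2 + t\<^sup>2 = 1\<close> and its trace is \<open>2c\<close> with \<open>c = s(z + z\<^sup>-\<^sup>1)/2\<close>, so Cayley--Hamilton gives
  \<open>M\<^sup>n = T\<^sub>n(c) I + U\<^sub>n\<^sub>-\<^sub>1(c) (M - c I)\<close>, whose columns are \<open>(p\<^sub>n\<^sup>1, p\<^sub>n\<^sup>2)\<close> and \<open>(q\<^sub>n\<^sup>1, q\<^sub>n\<^sup>2)\<close>.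
\<close>

section \<open>Unitary operators and their integer powers\<close>

lemma cinner_minus_left: "cinner (- x) y = - cinner x y"
  using cinner_scaleC_left[of "- 1" x y] scaleR_scaleC[of "- 1" x] by simp

lemma cinner_minus_right: "cinner x (- y) = - cinner x y"
  by (metis cinner_commute cinner_minus_left complex_cnj_minus)

lemma cinner_scaleR_left: "cinner (r *\<^sub>R x) y = complex_of_real r * cinner x y"
  by (simp add: scaleR_scaleC cinner_scaleC_left)

lemma unitary_op_cinner: "unitary_op A \<Longrightarrow> cinner (A x) (A y) = cinner x y"
  by (simp add: unitary_op_def)

lemma unitary_op_bij: "unitary_op A \<Longrightarrow> bij A"
  by (simp add: bij_def unitary_op_inj) (simp add: unitary_op_def)

lemma unitary_op_linear:
  assumes "unitary_op A"
  shows "linear A"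
proof -
  interpret Vector_Spaces.linear scaleC scaleC A
    using assms by (simp add: unitary_op_def)
  show ?thesis
    by (rule linearI) (simp_all add: add scaleR_scaleC scale)
qed

lemma op_powi_add_one:
  assumes "bij A"
  shows "op_powi A (k + 1) v = A (op_powi A k v)"
proof (cases "0 \<le> k")
  case True
  then have "nat (k + 1) = Suc (nat k)" by simp
  with True show ?thesis by (simp add: op_powi_def)
next
  case False
  then have k: "nat (- k) = Suc (nat (- (k + 1)))" by simp
  have "A (op_powi A k v) = (inv A ^^ nat (- (k + 1))) v"
    using False k assms by (simp add: op_powi_def bij_is_surj surj_f_inv_f)
  \<comment> \<open>At \<open>k = - 1\<close> the exponent \<open>k + 1\<close> falls into the
    nonnegative branch of \<open>op_powi\<close>; both sides are then \<open>v\<close>.\<close>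
  also have "\<dots> = op_powi A (k + 1) v"
    using False by (cases "k = - 1") (simp_all add: op_powi_def)
  finally show ?thesis by simp
qed

section \<open>Recurrences of the Chebyshev polynomials\<close>

text \<open>Stated without subtraction, as \<open>poly_laurent\<close> is only shown to be additive.\<close>

lemma cheb_T_rec:
  "cheb_T (Suc (Suc n)) + cheb_U n
    = pCons 0 (cheb_T (Suc n)) + pCons 0 (pCons 0 (cheb_U n))"
proof (rule poly_eq_if_eq_on_cos)
  fix \<theta> :: real assume nz: "sin \<theta> \<noteq> 0"
  define \<alpha> where "\<alpha> = real (Suc n) * \<theta>"
  have "real (Suc (Suc n)) * \<theta> = \<alpha> + \<theta>" by (simp add: \<alpha>_def algebra_simps)
  then have T: "poly (cheb_T (Suc (Suc n))) (cos \<theta>) = cos \<alpha> * cos \<theta> - sin \<alpha> * sin \<theta>"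
    by (simp only: cheb_T_cos cos_add)
  have T': "poly (cheb_T (Suc n)) (cos \<theta>) = cos \<alpha>" by (simp only: cheb_T_cos \<alpha>_def)
  have U: "poly (cheb_U n) (cos \<theta>) * sin \<theta> = sin \<alpha>"
    using nz by (simp add: cheb_U_cos \<alpha>_def algebra_simps)
  have "(cos \<theta>)\<^sup>2 = 1 - (sin \<theta>)\<^sup>2" by (simp add: cos_squared_eq)
  then show "poly (cheb_T (Suc (Suc n)) + cheb_U n) (cos \<theta>)
      = poly (pCons 0 (cheb_T (Suc n)) + pCons 0 (pCons 0 (cheb_U n))) (cos \<theta>)"
    unfolding poly_add poly_pCons T T' U[symmetric] by algebra
qed

text \<open>The addition formula for sin(\<alpha> + \<theta>), divided by sin \<theta>.\<close>

lemma cheb_U_rec: "cheb_U (Suc n) = cheb_T (Suc n) + pCons 0 (cheb_U n)"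
proof (rule poly_eq_if_eq_on_cos)
  fix \<theta> :: real assume nz: "sin \<theta> \<noteq> 0"
  define \<alpha> where "\<alpha> = real (Suc n) * \<theta>"
  have "real (Suc n + 1) * \<theta> = \<alpha> + \<theta>" by (simp add: \<alpha>_def algebra_simps)
  then have U: "poly (cheb_U (Suc n)) (cos \<theta>) = sin (\<alpha> + \<theta>) / sin \<theta>"
    by (simp only: cheb_U_cos[OF nz])
  have U': "poly (cheb_U n) (cos \<theta>) = sin \<alpha> / sin \<theta>"
    by (simp add: cheb_U_cos[OF nz] \<alpha>_def)
  have T: "poly (cheb_T (Suc n)) (cos \<theta>) = cos \<alpha>" by (simp only: cheb_T_cos \<alpha>_def)
  show "poly (cheb_U (Suc n)) (cos \<theta>) = poly (cheb_T (Suc n) + pCons 0 (cheb_U n)) (cos \<theta>)"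
    unfolding poly_add poly_pCons U U' T using nz by (simp add: sin_add field_simps)
qed

lemma cheb_T_1: "cheb_T (Suc 0) = [:0, 1:]"
  by (rule poly_eq_if_eq_on_cos) (simp add: cheb_T_cos)

lemma cheb_U_0: "cheb_U 0 = 1"
  by (rule poly_eq_if_eq_on_cos) (simp add: cheb_U_cos)

section \<open>Evaluation and coefficients of Laurent polynomials\<close>

lemma poly_laurent_add: "poly_laurent (p + q) a = poly_laurent p a + poly_laurent q a"
proof -
  have "map_poly laurent_const (p + q) = map_poly laurent_const p + map_poly laurent_const q"
    by (rule poly_eqI) (simp add: coeff_map_poly single_add)
  then show ?thesis by (simp add: poly_laurent_def)
qed

lemma poly_laurent_pCons: "poly_laurent (pCons c p) a = laurent_const c + a * poly_laurent p a"
  by (simp add: poly_laurent_def map_poly_pCons)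

lemma poly_laurent_0: "poly_laurent 0 a = 0"
  by (simp add: poly_laurent_def)

lemma poly_laurent_1: "poly_laurent 1 a = 1"
  by (simp add: poly_laurent_def)

text \<open>Turns the monomials in the recursions below into shifts of the position.\<close>

lemma lookup_single_times:
  fixes p :: "'a::ab_group_add \<Rightarrow>\<^sub>0 'b::semiring_0"
  shows "Poly_Mapping.lookup (Poly_Mapping.single k a * p) x = a * Poly_Mapping.lookup p (x - k)"
proof -
  have "x = k + q \<longleftrightarrow> x - k = q" for q by (auto simp: algebra_simps)
  then show ?thesis
    by (simp add: lookup_mult lookup_single when_mult)
qed

section \<open>Recursion of the walk polynomials\<close>

abbreviation walk_c :: "real \<Rightarrow> laurent"
  where "walk_c s \<equiv> laurent_const (s / 2) * (laurent_z + laurent_z_inv)"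

lemma walk_poly_T_rec:
  "poly_laurent (cheb_T (Suc (Suc n))) a
    = a * poly_laurent (cheb_T (Suc n)) a + (a * a - 1) * poly_laurent (cheb_U n) a"
  using arg_cong[OF cheb_T_rec[of n], of "\<lambda>p. poly_laurent p a"]
  by (simp add: poly_laurent_add poly_laurent_pCons algebra_simps)

lemma walk_poly_U_rec:
  "poly_laurent (cheb_U (Suc n)) a
    = poly_laurent (cheb_T (Suc n)) a + a * poly_laurent (cheb_U n) a"
  by (simp add: cheb_U_rec poly_laurent_add poly_laurent_pCons)

lemma laurent_z_z_inv: "laurent_z * laurent_z_inv = 1"
  by (simp add: mult_single)

text \<open>Rewrites everything in the single atom \<open>laurent_const (s / 2)\<close>, as
  \<open>algebra\<close> cannot relate it to \<open>laurent_const s\<close>.\<close>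

lemma laurent_const_double: "laurent_const s = laurent_const (s / 2) + laurent_const (s / 2)"
  by (simp flip: single_add)

lemma laurent_const_sq:
  assumes "s\<^sup>2 + t\<^sup>2 = 1"
  shows "4 * (laurent_const (s / 2))\<^sup>2 + (laurent_const t)\<^sup>2 = 1"
proof -
  have "4 * (laurent_const (s / 2))\<^sup>2 + (laurent_const t)\<^sup>2
      = (laurent_const s)\<^sup>2 + (laurent_const t)\<^sup>2"
    unfolding laurent_const_double[of s] by algebra
  also have "\<dots> = laurent_const (s\<^sup>2 + t\<^sup>2)"
    by (simp add: power2_eq_square mult_single single_add)
  finally show ?thesis using assms by simp
qed

context
  fixes s t :: real
  assumes st: "s\<^sup>2 + t\<^sup>2 = 1"
begin

lemmas laurent_relations = laurent_z_z_inv laurent_const_sq[OF st]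

text \<open>With the next three lemmas, the entries of M^(n+2) = M M^(n+1). They start at exponent 1
  because \<open>n - 1\<close> truncates at \<open>n = 0\<close>. The diagonal entries use the
  determinant and z z^-1 = 1; the others are plain ring identities.\<close>

lemma walk_p1_Suc:
  "walk_p1 s (Suc (Suc n)) = laurent_const s * laurent_z * walk_p1 s (Suc n)
    - laurent_const t * laurent_z_inv * walk_p2 s t (Suc n)"
  unfolding walk_p1_def walk_p2_def diff_Suc_1 walk_poly_T_rec walk_poly_U_rec
    laurent_const_double[of s]
  using laurent_relations by algebra

lemma walk_p2_Suc:
  "walk_p2 s t (Suc (Suc n)) = laurent_const t * laurent_z * walk_p1 s (Suc n)
    + laurent_const s * laurent_z_inv * walk_p2 s t (Suc n)"
  unfolding walk_p1_def walk_p2_def diff_Suc_1 walk_poly_T_rec walk_poly_U_rec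
    laurent_const_double[of s]
  by (simp add: algebra_simps)

lemma walk_q1_Suc:
  "walk_q1 s t (Suc (Suc n)) = laurent_const s * laurent_z * walk_q1 s t (Suc n)
    - laurent_const t * laurent_z_inv * walk_q2 s (Suc n)"
  unfolding walk_q1_def walk_q2_def diff_Suc_1 walk_poly_T_rec walk_poly_U_rec
    laurent_const_double[of s]
  by (simp add: algebra_simps)

lemma walk_q2_Suc:
  "walk_q2 s (Suc (Suc n)) = laurent_const t * laurent_z * walk_q1 s t (Suc n)
    + laurent_const s * laurent_z_inv * walk_q2 s (Suc n)"
  unfolding walk_q1_def walk_q2_def diff_Suc_1 walk_poly_T_rec walk_poly_U_rec
    laurent_const_double[of s]
  using laurent_relations by algebra

end

text \<open>The four values at 1 are the entries of M, the base of the induction.\<close>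

lemma walk_p1_1: "walk_p1 s (Suc 0) = Poly_Mapping.single 1 s"
proof -
  have "walk_p1 s (Suc 0) = laurent_const s * laurent_z"
    unfolding walk_p1_def laurent_const_double[of s]
    by (simp add: cheb_T_1 cheb_U_0 poly_laurent_pCons poly_laurent_0 poly_laurent_1 algebra_simps)
  then show ?thesis by (simp add: mult_single)
qed

lemma walk_q2_1: "walk_q2 s (Suc 0) = Poly_Mapping.single (- 1) s"
proof -
  have "walk_q2 s (Suc 0) = laurent_const s * laurent_z_inv"
    unfolding walk_q2_def laurent_const_double[of s]
    by (simp add: cheb_T_1 cheb_U_0 poly_laurent_pCons poly_laurent_0 poly_laurent_1 algebra_simps)
  then show ?thesis by (simp add: mult_single)
qed

lemma walk_p2_1: "walk_p2 s t (Suc 0) = Poly_Mapping.single 1 t"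
  by (simp add: walk_p2_def cheb_U_0 poly_laurent_1 mult_single)

lemma walk_q1_1: "walk_q1 s t (Suc 0) = Poly_Mapping.single (- 1) (- t)"
  by (simp add: walk_q1_def cheb_U_0 poly_laurent_1 mult_single flip: single_uminus)

section \<open>Action of the operators on the position vectors\<close>

locale quantum_walk =
  fixes V W \<sigma> :: "'a::complex_hilbert_space \<Rightarrow> 'a" and e :: 'a
  assumes V: "unitary_op V" and W: "unitary_op W" and \<sigma>: "unitary_op \<sigma>"
    and WW: "W (W v) = - v"
    and VW: "V \<circ> W = W \<circ> inv V"
    and \<sigma>W: "\<sigma> (W v) + W (\<sigma> v) = 0" and \<sigma>V: "\<sigma> (V v) - V (\<sigma> v) = 0"
    and \<sigma>_adj: "cadjoint \<sigma> = \<sigma>"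
    and e: "e \<in> range (pi_plus \<sigma>)" "norm e = 1"
    and orth: "\<And>k::nat. k > 0 \<Longrightarrow> cinner ((V ^^ k) e) e = 0"
begin

abbreviation "e1 \<equiv> walk_e1 V \<sigma> e"
abbreviation "e2 \<equiv> walk_e2 V W \<sigma> e"
abbreviation "T \<equiv> walk_T V \<sigma>"

lemma V_inv [simp]: "V (inv V v) = v" "inv V (V v) = v"
  using unitary_op_bij[OF V] by (simp_all add: bij_is_surj bij_is_inj surj_f_inv_f)

lemma \<sigma>\<sigma> [simp]: "\<sigma> (\<sigma> v) = v"
  using \<sigma>_adj unitary_op_cadjoint[OF \<sigma>] unitary_op_bij[OF \<sigma>]
  by (metis bij_is_inj inv_f_f)

lemma \<sigma>_V: "\<sigma> (V v) = V (\<sigma> v)" using \<sigma>V[of v] by simp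

lemma \<sigma>_inv_V: "\<sigma> (inv V v) = inv V (\<sigma> v)"
  by (metis V_inv \<sigma>_V)

lemma \<sigma>_W: "\<sigma> (W v) = - W (\<sigma> v)"
  using \<sigma>W[of v] by (simp add: eq_neg_iff_add_eq_0)

lemma V_W: "V (W v) = W (inv V v)"
  using fun_cong[OF VW, of v] by simp

lemma W_V: "W (V v) = inv V (W v)"
  using V_W[of "V v"] by (metis V_inv)

lemma \<sigma>_e [simp]: "\<sigma> e = e"
proof -
  interpret S: linear \<sigma> using \<sigma> by (rule unitary_op_linear)
  from e(1) obtain v where "e = (1/2) *\<^sub>R (v + \<sigma> v)" by (auto simp: pi_plus_def)
  then show ?thesis by (simp add: S.scale S.add add.commute)
qed

text \<open>The factors \<open>\<i>\<close> and \<open>1 / (2 * \<i>)\<close> combine to 1/2 and the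
  adjoint of \<open>V\<close> is its inverse, so T is V on the +1 part of \<open>\<sigma>\<close>
  and V^-1 on the -1 part.\<close>

lemma T_eq: "T v = (1/2) *\<^sub>R (V v + inv V v + \<sigma> (V v) - \<sigma> (inv V v))"
proof -
  interpret S: Vector_Spaces.linear scaleC scaleC \<sigma> using \<sigma> by (simp add: unitary_op_def)
  interpret R: linear \<sigma> using \<sigma> by (rule unitary_op_linear)
  have "\<i> *\<^sub>C \<sigma> ((1 / (2 * \<i>)) *\<^sub>C w) = (1/2) *\<^sub>R \<sigma> w" for w
    by (subst S.scale) (simp add: scaleC_scaleC scaleR_scaleC)
  then have "T v = walk_X V v + (1/2) *\<^sub>R \<sigma> (V v - inv V v)"
    unfolding walk_T_def walk_Y_def unitary_op_cadjoint[OF V] by simp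
  then show ?thesis
    by (simp add: walk_X_def unitary_op_cadjoint[OF V] R.diff algebra_simps)
qed

lemma linear_inv_V: "linear (inv V)"
proof -
  interpret V: linear V using V by (rule unitary_op_linear)
  show ?thesis
    by (rule linearI) (metis V.add V_inv, metis V.scale V_inv)
qed

lemma T_scaleR: "T (c *\<^sub>R v) = c *\<^sub>R T v"
proof -
  interpret S: linear \<sigma> using \<sigma> by (rule unitary_op_linear)
  interpret V: linear V using V by (rule unitary_op_linear)
  interpret I: linear "inv V" by (rule linear_inv_V)
  show ?thesis
    by (simp add: T_eq S.scale V.scale I.scale scaleR_add_right scaleR_diff_right mult.commute)
qed

lemma bij_T: "bij T"
proof -
  interpret S: linear \<sigma> using \<sigma> by (rule unitary_op_linear)
  interpret V: linear V using V by (rule unitary_op_linear)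
  interpret I: linear "inv V" by (rule linear_inv_V)
  \<comment> \<open>The inverse of T: V^-1 on the +1 part and V on the -1 part. In both composites
    four copies of v/4 survive, which \<open>h\<close> collects.\<close>
  define T' where "T' v = (1/2) *\<^sub>R (V v + inv V v - \<sigma> (V v) + \<sigma> (inv V v))" for v
  have h: "(1/4) *\<^sub>R x + (1/4) *\<^sub>R x + (1/4) *\<^sub>R x + (1/4) *\<^sub>R x = x" for x :: 'a
    by (simp flip: scaleR_left.add)
  have "T' (T v) = v" "T (T' v) = v" for v
    by (simp_all add: T_eq T'_def S.scale S.add S.diff V.scale V.add V.diff I.scale I.add I.diff
        \<sigma>_V \<sigma>_inv_V scaleR_add_right scaleR_diff_right h)
  then show ?thesis by (metis bijI')
qed

lemma e1_0: "e1 0 = e" and e2_0: "e2 0 = V (W e)"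
  by (simp_all add: walk_e1_def walk_e2_def op_powi_def)

lemma T_plus: "\<sigma> v = v \<Longrightarrow> T v = V v"
  by (simp add: T_eq \<sigma>_V \<sigma>_inv_V flip: scaleR_2)

lemma T_minus: "\<sigma> v = - v \<Longrightarrow> T v = inv V v"
proof -
  interpret V: linear V using V by (rule unitary_op_linear)
  assume v: "\<sigma> v = - v"
  have "\<sigma> (inv V v) = - inv V v"
    by (metis V.neg V_inv(1,2) \<sigma>_inv_V v)
  with v show ?thesis by (simp add: T_eq \<sigma>_V V.neg flip: scaleR_2)
qed

lemma e1_Suc_T: "e1 (x + 1) = T (e1 x)" and e2_Suc_T: "e2 (x + 1) = T (e2 x)"
  by (simp_all add: walk_e1_def walk_e2_def op_powi_add_one[OF bij_T])

lemma T_\<sigma>: "T (\<sigma> v) = \<sigma> (T v)"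
proof -
  interpret S: linear \<sigma> using \<sigma> by (rule unitary_op_linear)
  show ?thesis
    by (simp add: T_eq \<sigma>_V \<sigma>_inv_V S.scale S.add S.diff)
qed

text \<open>T commutes with \<open>\<sigma>\<close>, so its integer powers preserve both eigenspaces
  (\<open>c\<close> is 1 or -1 below).\<close>

lemma \<sigma>_op_powi_T:
  assumes "\<sigma> v = c *\<^sub>R v"
  shows "\<sigma> (op_powi T x v) = c *\<^sub>R op_powi T x v"
proof (induction x rule: int_induct[where k = 0])
  case base
  show ?case by (simp add: op_powi_def assms)
next
  case (step1 i)
  then show ?case by (simp add: op_powi_add_one[OF bij_T] T_scaleR flip: T_\<sigma>)
next
  case (step2 i)
  have "T (op_powi T (i - 1) v) = op_powi T i v"
    using op_powi_add_one[OF bij_T, of "i - 1"] by simp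
  \<comment> \<open>The downward step cancels T by injectivity.\<close>
  then have "T (\<sigma> (op_powi T (i - 1) v)) = T (c *\<^sub>R op_powi T (i - 1) v)"
    by (simp only: T_\<sigma> T_scaleR step2.IH)
  then show ?case
    using bij_T by (metis bij_is_inj inj_eq)
qed

lemma \<sigma>_e1: "\<sigma> (e1 x) = e1 x"
  using \<sigma>_op_powi_T[of e 1] by (simp add: walk_e1_def)

lemma \<sigma>_e2: "\<sigma> (e2 x) = - e2 x"
proof -
  interpret V: linear V using V by (rule unitary_op_linear)
  show ?thesis
    using \<sigma>_op_powi_T[of "V (W e)" "- 1"] by (simp add: walk_e2_def \<sigma>_V \<sigma>_W V.neg)
qed

lemma V_e1: "V (e1 x) = e1 (x + 1)"
  by (simp add: e1_Suc_T T_plus \<sigma>_e1)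

lemma V_e2: "V (e2 x) = e2 (x - 1)"
  using e2_Suc_T[of "x - 1"] by (simp add: T_minus \<sigma>_e2)

text \<open>Since W V = V^-1 W and V^-1 raises the index of \<open>e2\<close>, both indices move
  together. The offset comes from \<open>e2 0 = V (W e)\<close>, which is also
  \<open>V (e2 1)\<close>.\<close>

lemma W_e1: "W (e1 x) = e2 (x + 1)"
proof (induction x rule: int_induct[where k = 0])
  case base
  have "V (W e) = V (e2 1)" by (simp add: V_e2 e2_0)
  then show ?case by (simp add: e1_0) (metis V_inv(2))
next
  case (step1 i)
  have "W (e1 (i + 1)) = inv V (e2 (i + 1))"
    by (simp add: W_V step1 flip: V_e1)
  also have "\<dots> = e2 (i + 1 + 1)" 
    by (metis V_e2 V_inv(2) add_diff_cancel_right')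
  finally show ?case .
next
  case (step2 i)
  have "e1 (i - 1) = inv V (e1 i)"
    by (metis V_e1 V_inv(2) diff_add_cancel)
  then have "W (e1 (i - 1)) = V (e2 (i + 1))"
    by (metis V_W step2.IH)
  then show ?case by (simp add: V_e2)
qed

lemma W_e2: "W (e2 x) = - e1 (x - 1)"
  using W_e1[of "x - 1"] WW[of "e1 (x - 1)"] by simp

section \<open>Orthonormality relations\<close>

lemma cinner_e1_shift: "cinner (e1 (x + int k)) (e1 (y + int k)) = cinner (e1 x) (e1 y)"
proof (induction k)
  case (Suc k)
  then show ?case
    using unitary_op_cinner[OF V, of "e1 (x + int k)" "e1 (y + int k)"]
    by (simp add: V_e1 algebra_simps)
qed simp

lemma e1_nat: "e1 (int k) = (V ^^ k) e"
  by (induction k) (simp_all add: e1_0 V_e1[symmetric] add.commute[of 1])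

text \<open>(QWR) covers one sign of \<open>x\<close>; conjugate symmetry and a shift by
  \<open>- x\<close> give the rest.\<close>

lemma cinner_e1: "cinner (e1 0) (e1 x) = of_bool (x = 0)"
proof -
  have pos: "cinner (e1 (int k)) (e1 0) = 0" if "k > 0" for k
    using orth[OF that] by (simp add: e1_nat e1_0)
  consider "x = 0" | "x > 0" | "x < 0" by linarith
  then show ?thesis
  proof cases
    case 1
    then show ?thesis by (simp add: e1_0 cinner_self e)
  next
    case 2
    then have "cinner (e1 x) (e1 0) = 0" using pos[of "nat x"] by simp
    with 2 show ?thesis by (subst cinner_commute) simp
  next
    case 3
    with cinner_e1_shift[of 0 "nat (- x)" x] pos[of "nat (- x)"] show ?thesis by simp
  qed
qed

lemma cinner_e2: "cinner (e2 0) (e2 x) = of_bool (x = 0)"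
  using unitary_op_cinner[OF W, of "e1 (- 1)" "e1 (x - 1)"] cinner_e1_shift[of "- 1" 1 "x - 1"]
  by (simp add: W_e1 cinner_e1)

text \<open>Unitarity of \<open>\<sigma>\<close>, with eigenvalues 1 and -1, makes the product equal
  to its own negative.\<close>

lemma cinner_e1_e2: "cinner (e1 x) (e2 y) = 0"
  using unitary_op_cinner[OF \<sigma>, of "e1 x" "e2 y"]
  by (simp add: \<sigma>_e1 \<sigma>_e2 cinner_minus_right eq_neg_iff_add_eq_0)

lemma cinner_e2_e1: "cinner (e2 x) (e1 y) = 0"
  by (subst cinner_commute) (simp add: cinner_e1_e2)

section \<open>Amplitudes of the walk\<close>

text \<open>Unitarity moves \<open>V\<close> and \<open>W\<close> onto the position vectors, so an
  arbitrary \<open>v\<close> needs no expansion in them.\<close>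

lemma cinner_walk_U_e1:
  "cinner (walk_U V W s t v) (e1 x) = s * cinner v (e1 (x - 1)) - t * cinner v (e2 (x + 1))"
proof -
  have "cinner (W v) (e1 x) = - cinner v (e2 (x + 1))"
    using unitary_op_cinner[OF W, of v "e2 (x + 1)"]
    by (simp add: W_e2 cinner_minus_right minus_equation_iff[of "cinner (W v) (e1 x)"])
  then show ?thesis
    using unitary_op_cinner[OF V, of v "e1 (x - 1)"]
    by (simp add: V_e1 walk_U_def cinner_add_left cinner_scaleR_left)
qed

lemma cinner_walk_U_e2:
  "cinner (walk_U V W s t v) (e2 x) = t * cinner v (e1 (x - 1)) + s * cinner v (e2 (x + 1))"
  using unitary_op_cinner[OF W, of v "e1 (x - 1)"] unitary_op_cinner[OF V, of v "e2 (x + 1)"]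
  by (simp add: V_e2 W_e1 walk_U_def cinner_add_left cinner_scaleR_left)

lemma walk_amplitude:
  fixes \<psi> :: "complex^2"
  assumes st: "s\<^sup>2 + t\<^sup>2 = 1"
  defines "\<Psi> \<equiv> walk_init V W \<sigma> e \<psi>"
  shows "cinner ((walk_U V W s t ^^ Suc n) \<Psi>) (e1 x)
        = \<psi>$1 * laurent_coeff x (walk_p1 s (Suc n)) + \<psi>$2 * laurent_coeff x (walk_q1 s t (Suc n))
    \<and> cinner ((walk_U V W s t ^^ Suc n) \<Psi>) (e2 x)
        = \<psi>$1 * laurent_coeff x (walk_p2 s t (Suc n)) + \<psi>$2 * laurent_coeff x (walk_q2 s (Suc n))"
proof (induction n arbitrary: x)
  case 0
  have "cinner \<Psi> (e1 x) = \<psi>$1 * of_bool (x = 0)" "cinner \<Psi> (e2 x) = \<psi>$2 * of_bool (x = 0)" for x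
    by (simp_all add: \<Psi>_def walk_init_def cinner_add_left cinner_scaleC_left cinner_e1 cinner_e2
        cinner_e1_e2 cinner_e2_e1)
  then show ?case
    by (auto simp: cinner_walk_U_e1 cinner_walk_U_e2 walk_p1_1 walk_p2_1 walk_q1_1 walk_q2_1
        lookup_single when_def)
next
  case (Suc n)
  note IH = Suc.IH[THEN conjunct1] Suc.IH[THEN conjunct2]
  show ?case
    \<comment> \<open>Only the last application of U is peeled off, leaving the iterate in
      \<open>IH\<close>. Nesting products to the right lets \<open>lookup_single_times\<close> strip
      constant and monomial in turn.\<close>
    unfolding funpow.simps(2)[of "Suc n"] o_apply cinner_walk_U_e1 cinner_walk_U_e2 IH
      walk_p1_Suc[OF st] walk_p2_Suc[OF st] walk_q1_Suc[OF st] walk_q2_Suc[OF st]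
      mult.assoc lookup_single_times lookup_add lookup_minus
    by (simp add: algebra_simps)
qed

end

section \<open>Probabilities and characteristic function\<close>

text \<open>As \<open>p\<close> and \<open>q\<close> are real, they factor out of the interference
  term.\<close>

lemma cmod_add_real_mult_sq:
  "(cmod (a * complex_of_real p + b * complex_of_real q))\<^sup>2
    = (cmod a)\<^sup>2 * p\<^sup>2 + (cmod b)\<^sup>2 * q\<^sup>2 + 2 * Re (a * cnj b) * (p * q)"
  unfolding cmod_power2 by (simp add: power2_eq_square algebra_simps)

lemma fourier_sum_eq_sum:
  assumes "finite S" and "\<And>x. x \<notin> S \<Longrightarrow> f x = 0"
  shows "fourier_sum f \<xi>
    = (\<Sum>x\<in>S. complex_of_real (f x) * exp (\<i> * complex_of_real (\<xi> * real_of_int x)))"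
proof -
  have "fourier_sum f \<xi>
      = (\<Sum>\<^sub>\<infinity>x\<in>S. complex_of_real (f x) * exp (\<i> * complex_of_real (\<xi> * real_of_int x)))"
    unfolding fourier_sum_def by (rule infsum_cong_neutral) (use assms in auto)
  then show ?thesis using assms(1) by simp
qed

theorem lemma6:
  fixes V W \<sigma> :: "'a::complex_hilbert_space \<Rightarrow> 'a"
    and e :: 'a and s t :: real and \<psi> :: "complex^2" and n :: nat
  assumes "unitary_op V" and "unitary_op W" and "unitary_op \<sigma>"
    and QW1: "\<forall>v. W (W v) = - v"
    and QW2: "V \<circ> W = W \<circ> inv V"
    and QW3: "\<forall>v. \<sigma> (W v) + W (\<sigma> v) = 0" "\<forall>v. \<sigma> (V v) - V (\<sigma> v) = 0"
    and QW4: "cadjoint \<sigma> = \<sigma>"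
    and QWR: "e \<in> range (pi_plus \<sigma>)" "norm e = 1" "\<forall>x::nat. x > 0 \<longrightarrow> cinner ((V ^^ x) e) e = 0"
    and "s\<^sup>2 + t\<^sup>2 = 1" and "norm \<psi> = 1" and "n > 0"
  shows "(\<forall>x. walk_dist V W \<sigma> e s t n \<psi> x =
            (cmod (\<psi>$1))\<^sup>2 * ((laurent_coeff x (walk_p1 s n))\<^sup>2 + (laurent_coeff x (walk_p2 s t n))\<^sup>2)
          + (cmod (\<psi>$2))\<^sup>2 * ((laurent_coeff x (walk_q1 s t n))\<^sup>2 + (laurent_coeff x (walk_q2 s n))\<^sup>2)
          + 2 * Re (\<psi>$1 * cnj (\<psi>$2)) *
              (laurent_coeff x (walk_p1 s n) * laurent_coeff x (walk_q1 s t n)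
               + laurent_coeff x (walk_p2 s t n) * laurent_coeff x (walk_q2 s n)))
    \<and> (\<forall>\<xi>. fourier_sum (walk_dist V W \<sigma> e s t n \<psi>) \<xi> =
            complex_of_real ((cmod (\<psi>$1))\<^sup>2) *
              (fourier_sum (\<lambda>x. (laurent_coeff x (walk_p1 s n))\<^sup>2) \<xi>
               + fourier_sum (\<lambda>x. (laurent_coeff x (walk_p2 s t n))\<^sup>2) \<xi>)
          + complex_of_real ((cmod (\<psi>$2))\<^sup>2) *
              (fourier_sum (\<lambda>x. (laurent_coeff x (walk_q1 s t n))\<^sup>2) \<xi>
               + fourier_sum (\<lambda>x. (laurent_coeff x (walk_q2 s n))\<^sup>2) \<xi>)
          + complex_of_real (2 * Re (\<psi>$1 * cnj (\<psi>$2))) *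
              (fourier_sum (\<lambda>x. laurent_coeff x (walk_p1 s n) * laurent_coeff x (walk_q1 s t n)) \<xi>
               + fourier_sum (\<lambda>x. laurent_coeff x (walk_p2 s t n) * laurent_coeff x (walk_q2 s n)) \<xi>))"
proof -
  interpret quantum_walk V W \<sigma> e
    using assms by unfold_locales auto
  obtain m where n: "n = Suc m" using \<open>n > 0\<close> by (cases n) auto
  let ?p1 = "\<lambda>x. laurent_coeff x (walk_p1 s n)" and ?p2 = "\<lambda>x. laurent_coeff x (walk_p2 s t n)"
  let ?q1 = "\<lambda>x. laurent_coeff x (walk_q1 s t n)" and ?q2 = "\<lambda>x. laurent_coeff x (walk_q2 s n)"
  note amplitude = walk_amplitude[OF \<open>s\<^sup>2 + t\<^sup>2 = 1\<close>]
  have dist: "walk_dist V W \<sigma> e s t n \<psi> x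
      = (cmod (\<psi>$1))\<^sup>2 * ((?p1 x)\<^sup>2 + (?p2 x)\<^sup>2) + (cmod (\<psi>$2))\<^sup>2 * ((?q1 x)\<^sup>2 + (?q2 x)\<^sup>2)
        + 2 * Re (\<psi>$1 * cnj (\<psi>$2)) * (?p1 x * ?q1 x + ?p2 x * ?q2 x)" for x
    unfolding walk_dist_def n amplitude[THEN conjunct1] amplitude[THEN conjunct2] cmod_add_real_mult_sq
    by (simp only: ring_distribs)
  \<comment> \<open>One finite set carries all seven Fourier series, so linearity is that of finite
    sums.\<close>
  define S where "S = Poly_Mapping.keys (walk_p1 s n) \<union> Poly_Mapping.keys (walk_p2 s t n)
    \<union> Poly_Mapping.keys (walk_q1 s t n) \<union> Poly_Mapping.keys (walk_q2 s n)"
  have S: "finite S" by (simp add: S_def)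
  have off: "?p1 x = 0" "?p2 x = 0" "?q1 x = 0" "?q2 x = 0" if "x \<notin> S" for x
    using that by (simp_all add: S_def in_keys_iff)
  note four = fourier_sum_eq_sum[OF S]
  show ?thesis
    by (intro conjI allI dist)
      (simp add: four dist off sum.distrib sum_distrib_left algebra_simps)
qed

end
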